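(* Let $m\ge1$. In the preemptive setting, no deterministic online algorithm for makespan minimization on $m$ identical machines with testing is $c$-competitive for any $c<2-\frac2m+\frac1{m^2}$. This holds even when restricted to instances in which all testing times equal $1$.
   Context: Scheduling with testing on $m$ identical parallel machines: there are $n$ jobs; each job $j$ has a testing time $t_j\ge 0$, an upper bound $u_j\ge 0$ and a processing time $p_j$ with $0\le p_j\le u_j$. A job can either be run untested, requiring total processing $u_j$, or be tested (total processing $t_j$) and then executed (total processing $p_j$); the value $p_j$ is revealed to the algorithm only when the test of $j$ is completed. Initially the algorithm knows $m$, $n$ and all $t_j,u_j$, but not the $p_j$. Preemptive setting: a job may be interrupted at any time and continued later on a possibly different machine, but no two machines may work on the same job at the same time; if a job is tested, every part of its test must be processed before any part of its execution. The objective is the makespan. $\mathrm{OPT}$ denotes the optimal makespan of an offline scheduler knowing all $p_j$. A deterministic algorithm is $c$-competitive if its makespan $\mathrm{ALG}$ satisfies $\mathrm{ALG}\le c\cdot\mathrm{OPT}$ on every instance. *)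

theory Defs
  imports "HOL-Analysis.Analysis"
begin

record testing_instance =
  test_time :: "real list"
  upper_bound :: "real list"
  proc_time :: "real list"

definition num_jobs :: "testing_instance \<Rightarrow> nat" where
  "num_jobs I = length (test_time I)"

definition valid_instance :: "testing_instance \<Rightarrow> bool" where
  "valid_instance I \<longleftrightarrow>
     length (upper_bound I) = num_jobs I \<and> length (proc_time I) = num_jobs I \<and>
     (\<forall>j<num_jobs I. 0 \<le> test_time I ! j \<and> 0 \<le> upper_bound I ! j \<and>
        0 \<le> proc_time I ! j \<and> proc_time I ! j \<le> upper_bound I ! j)"

definition all_instances :: "testing_instance set" where
  "all_instances = {I. valid_instance I}"

definition unit_test_instances :: "testing_instance set" where
  "unit_test_instances = {I. valid_instance I \<and> (\<forall>j<num_jobs I. test_time I ! j = 1)}"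

text \<open>\<open>Run j\<close> is the untested run of job \<open>j\<close>; \<open>Exec j\<close> is its execution after a test.\<close>

datatype operation = Test nat | Exec nat | Run nat

fun job_of :: "operation \<Rightarrow> nat" where
  "job_of (Test j) = j"
| "job_of (Exec j) = j"
| "job_of (Run j) = j"

text \<open>\<open>activity S i x\<close> is what machine \<open>i\<close> does at time \<open>x\<close>, with \<open>None\<close> for idling; only machines
  below \<open>m\<close> and times \<open>x \<ge> 0\<close> are relevant. \<open>tests S\<close> lists the tested jobs with the completion
  times of their tests, in the order of completion. It is part of the schedule because a test of
  length 0 leaves no trace in \<open>activity\<close>, and because several such tests may be made one after the
  other, each depending on the outcome of the previous ones, at the same point in time.\<close>

record schedule =
  activity :: "nat \<Rightarrow> real \<Rightarrow> operation option"
  tests :: "(nat \<times> real) list"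

definition tested :: "schedule \<Rightarrow> nat set" where
  "tested S = fst ` set (tests S)"

text \<open>Total amount of processing that an operation has received before time \<open>x\<close>.\<close>

definition work :: "nat \<Rightarrow> schedule \<Rightarrow> operation \<Rightarrow> real \<Rightarrow> real" where
  "work m S a x = (\<Sum>i<m. measure lborel {y. 0 \<le> y \<and> y < x \<and> activity S i y = Some a})"

fun required_work :: "testing_instance \<Rightarrow> schedule \<Rightarrow> operation \<Rightarrow> real" where
  "required_work I S (Test j) =
     (if j < num_jobs I \<and> j \<in> tested S then test_time I ! j else 0)"
| "required_work I S (Exec j) =
     (if j < num_jobs I \<and> j \<in> tested S then proc_time I ! j else 0)"
| "required_work I S (Run j) =
     (if j < num_jobs I \<and> j \<notin> tested S then upper_bound I ! j else 0)"

definition completed_by :: "nat \<Rightarrow> testing_instance \<Rightarrow> schedule \<Rightarrow> real \<Rightarrow> bool" where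
  "completed_by m I S x \<longleftrightarrow> 0 \<le> x \<and>
     (\<forall>a. \<forall>y\<ge>x. work m S a y = required_work I S a) \<and>
     (\<forall>(j, \<tau>) \<in> set (tests S). \<tau> \<le> x)"

text \<open>The last clause of \<open>well_timed_tests\<close> says that \<open>\<tau>\<close> is the first time at which the whole test
  of \<open>j\<close> has been processed; a test of length 0 can be made at any time.\<close>

definition well_timed_tests :: "nat \<Rightarrow> testing_instance \<Rightarrow> schedule \<Rightarrow> bool" where
  "well_timed_tests m I S \<longleftrightarrow>
     distinct (map fst (tests S)) \<and> sorted (map snd (tests S)) \<and>
     (\<forall>(j, \<tau>) \<in> set (tests S). j < num_jobs I \<and> 0 \<le> \<tau> \<and>
        (\<forall>i<m. \<forall>x\<ge>0. activity S i x = Some (Test j) \<longrightarrow> x < \<tau>) \<and>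
        (\<forall>i<m. \<forall>x\<ge>0. activity S i x = Some (Exec j) \<longrightarrow> \<tau> \<le> x) \<and>
        (test_time I ! j > 0 \<longrightarrow> (\<forall>x<\<tau>. work m S (Test j) x < test_time I ! j)))"

definition feasible :: "nat \<Rightarrow> testing_instance \<Rightarrow> schedule \<Rightarrow> bool" where
  "feasible m I S \<longleftrightarrow>
     (\<forall>i<m. \<forall>a. {x. 0 \<le> x \<and> activity S i x = Some a} \<in> sets lborel) \<and>
     (\<forall>i<m. \<forall>x\<ge>0. \<forall>a. activity S i x = Some a \<longrightarrow>
        job_of a < num_jobs I \<and> (a = Run (job_of a) \<longleftrightarrow> job_of a \<notin> tested S)) \<and>
     (\<forall>x\<ge>0. \<forall>i<m. \<forall>i'<m. \<forall>a b. i \<noteq> i' \<and> activity S i x = Some a \<and> activity S i' x = Some b \<longrightarrow>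
        job_of a \<noteq> job_of b) \<and>
     well_timed_tests m I S \<and>
     (\<exists>x. completed_by m I S x)"

definition makespan :: "nat \<Rightarrow> testing_instance \<Rightarrow> schedule \<Rightarrow> real" where
  "makespan m I S = Inf {x. completed_by m I S x}"

definition OPT :: "nat \<Rightarrow> testing_instance \<Rightarrow> real" where
  "OPT m I = Inf {makespan m I S |S. feasible m I S}"

text \<open>\<open>A\<close> is given the complete instance, but may not anticipate: if two instances agree in all
  testing times and upper bounds, and in the processing times revealed by the first \<open>k\<close> completed
  tests, then \<open>A\<close> acts identically on them up to the completion of the next test, which is of the
  same job at the same time (or there is no further test in either case).\<close>

definition nonanticipating ::
  "nat \<Rightarrow> testing_instance set \<Rightarrow> (testing_instance \<Rightarrow> schedule) \<Rightarrow> bool" where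
  "nonanticipating m K A \<longleftrightarrow>
     (\<forall>I\<in>K. \<forall>J\<in>K. \<forall>k.
        test_time I = test_time J \<and> upper_bound I = upper_bound J \<and>
        (\<forall>(j, \<tau>) \<in> set (take k (tests (A I))). proc_time I ! j = proc_time J ! j) \<longrightarrow>
        take (Suc k) (tests (A I)) = take (Suc k) (tests (A J)) \<and>
        (\<forall>i<m. \<forall>x\<ge>0. (k < length (tests (A I)) \<longrightarrow> x < snd (tests (A I) ! k)) \<longrightarrow>
           activity (A I) i x = activity (A J) i x))"

definition online_algorithm ::
  "nat \<Rightarrow> testing_instance set \<Rightarrow> (testing_instance \<Rightarrow> schedule) \<Rightarrow> bool" where
  "online_algorithm m K A \<longleftrightarrow> (\<forall>I\<in>K. feasible m I (A I)) \<and> nonanticipating m K A"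

definition competitive ::
  "nat \<Rightarrow> testing_instance set \<Rightarrow> real \<Rightarrow> (testing_instance \<Rightarrow> schedule) \<Rightarrow> bool" where
  "competitive m K c A \<longleftrightarrow> (\<forall>I\<in>K. makespan m I (A I) \<le> c * OPT m I)"

end

theory Submission
  imports Defs
begin

text \<open>Fix an integer horizon \<open>T\<close>. The adversary releases \<open>T (m - 1) + 1\<close> jobs with unit tests
  and upper bounds so large that no job may be run untested. It reveals processing time 0 in every
  test except the last one to be completed, which reveals \<open>T - 1\<close>. All test work precedes this last
  completion, which therefore happens no earlier than \<open>(T (m - 1) + 1) / m\<close>, and the long job still
  needs \<open>T - 1\<close> more time units, since no two machines can share it. The offline scheduler
  dedicates one machine to the long job and puts \<open>T\<close> tests on each of the others, finishing by
  time \<open>T\<close>. The choice \<open>T = m\<close> gives the stated bound; letting \<open>T\<close> grow would give \<open>2 - 1 / m\<close>.\<close>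

section \<open>Work and elapsed time\<close>

lemma sum_measure_le_measure_superset:
  assumes "finite N" "disjoint_family_on A N" "B \<in> fmeasurable M"
    and sets: "\<And>k. k \<in> N \<Longrightarrow> A k \<in> sets M" and sub: "\<And>k. k \<in> N \<Longrightarrow> A k \<subseteq> B"
  shows "(\<Sum>k\<in>N. measure M (A k)) \<le> measure M B"
proof -
  have "emeasure M (A k) \<noteq> \<infinity>" if "k \<in> N" for k
    using fmeasurableI2[OF assms(3) sub[OF that] sets[OF that]] by (auto simp: fmeasurable_def)
  then have "(\<Sum>k\<in>N. measure M (A k)) = measure M (\<Union>k\<in>N. A k)"
    using assms by (intro measure_finite_Union[symmetric]) auto
  also have "\<dots> \<le> measure M B"
    using assms by (intro measure_mono_fmeasurable) auto
  finally show ?thesis .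
qed

lemma measure_lborel_Ico_eq_max: "measure lborel {l..<r::real} = max 0 (r - l)"
  by (cases "l \<le> r") auto

lemma fmeasurable_lborel_Ico: "{l..<r::real} \<in> fmeasurable lborel"
  by (rule fmeasurableI2[OF fmeasurable_compact[of "{l..r}"]]) auto

definition busy_set :: "schedule \<Rightarrow> operation \<Rightarrow> nat \<Rightarrow> real \<Rightarrow> real set" where
  "busy_set S a i x = {y. 0 \<le> y \<and> y < x \<and> activity S i y = Some a}"

lemma work_eq_sum_busy_set: "work m S a x = (\<Sum>i<m. measure lborel (busy_set S a i x))"
  by (simp add: work_def busy_set_def)

lemma busy_set_measurable:
  assumes "feasible m I S" "i < m"
  shows "busy_set S a i x \<in> sets lborel"
proof -
  have "busy_set S a i x = {y. 0 \<le> y \<and> activity S i y = Some a} \<inter> {..<x}"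
    by (auto simp: busy_set_def)
  moreover have "{y. 0 \<le> y \<and> activity S i y = Some a} \<in> sets lborel"
    using assms unfolding feasible_def by blast
  ultimately show ?thesis
    by (metis sets.Int sets_lborel lessThan_borel)
qed

lemma work_le_elapsed_time:
  assumes "feasible m I S"
    and start: "\<And>i y. i < m \<Longrightarrow> 0 \<le> y \<Longrightarrow> activity S i y = Some a \<Longrightarrow> \<tau> \<le> y"
  shows "work m S a x \<le> max 0 (x - \<tau>)"
  unfolding work_eq_sum_busy_set measure_lborel_Ico_eq_max[symmetric]
proof (rule sum_measure_le_measure_superset)
  show "disjoint_family_on (\<lambda>i. busy_set S a i x) {..<m}"
    using assms(1) unfolding feasible_def disjoint_family_on_def busy_set_def by blast
next
  fix i assume i: "i \<in> {..<m}"
  then show "busy_set S a i x \<subseteq> {\<tau>..<x}"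
    using start by (auto simp: busy_set_def)
  show "busy_set S a i x \<in> sets lborel"
    using busy_set_measurable[OF assms(1)] i by blast
qed (simp_all add: fmeasurable_lborel_Ico)

lemma sum_work_le_machine_time:
  assumes "feasible m I S" "finite N" "0 \<le> \<tau>"
    and deadline: "\<And>a i y. a \<in> N \<Longrightarrow> i < m \<Longrightarrow> 0 \<le> y \<Longrightarrow> activity S i y = Some a \<Longrightarrow> y < \<tau>"
  shows "(\<Sum>a\<in>N. work m S a x) \<le> real m * \<tau>"
proof -
  have "(\<Sum>a\<in>N. work m S a x) = (\<Sum>i<m. \<Sum>a\<in>N. measure lborel (busy_set S a i x))"
    unfolding work_eq_sum_busy_set by (rule sum.swap)
  also have "\<dots> \<le> (\<Sum>i<m. measure lborel {0..<\<tau>})"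
  proof (intro sum_mono sum_measure_le_measure_superset)
    fix i a assume "i \<in> {..<m}" "a \<in> N"
    then show "busy_set S a i x \<subseteq> {0..<\<tau>}" "busy_set S a i x \<in> sets lborel"
      using deadline busy_set_measurable[OF assms(1)] by (auto simp: busy_set_def)
  next
    show "disjoint_family_on (\<lambda>a. busy_set S a i x) N" for i
      by (auto simp: disjoint_family_on_def busy_set_def)
  qed (simp_all add: assms fmeasurable_lborel_Ico)
  finally show ?thesis
    using assms(3) by simp
qed

lemma work_single_interval:
  assumes "i\<^sub>0 < m" "0 \<le> l"
    and activity: "\<And>i y. activity S i y = Some a \<longleftrightarrow> i = i\<^sub>0 \<and> l \<le> y \<and> y < r"
  shows "work m S a x = max 0 (min x r - l)"
proof -
  have "busy_set S a i x = (if i = i\<^sub>0 then {l..<min x r} else {})" for i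
    using assms(2) by (auto simp: busy_set_def activity)
  then have "work m S a x = (\<Sum>i<m. if i = i\<^sub>0 then measure lborel {l..<min x r} else 0)"
    unfolding work_eq_sum_busy_set by (intro sum.cong) auto
  then show ?thesis
    using assms(1) by (simp add: measure_lborel_Ico_eq_max del: min_less_iff_conj)
qed

lemma work_eq_0:
  assumes "\<And>i y. activity S i y \<noteq> Some a"
  shows "work m S a x = 0"
  by (simp add: work_def assms)

section \<open>Bounds on the makespan\<close>

lemma
  assumes "feasible m I S"
  shows distinct_tested_jobs: "distinct (map fst (tests S))"
    and sorted_test_completions: "sorted (map snd (tests S))"
  using assms by (auto simp: feasible_def well_timed_tests_def)

lemma
  assumes "feasible m I S" "(j, \<tau>) \<in> set (tests S)"
  shows test_job_less: "j < num_jobs I"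
    and test_completion_nonneg: "0 \<le> \<tau>"
    and test_before_completion:
      "\<And>i x. i < m \<Longrightarrow> 0 \<le> x \<Longrightarrow> activity S i x = Some (Test j) \<Longrightarrow> x < \<tau>"
    and exec_after_test_completion:
      "\<And>i x. i < m \<Longrightarrow> 0 \<le> x \<Longrightarrow> activity S i x = Some (Exec j) \<Longrightarrow> \<tau> \<le> x"
  using assms unfolding feasible_def well_timed_tests_def by fast+

lemma finite_tested: "finite (tested S)"
  by (simp add: tested_def)

lemma tested_subset: "feasible m I S \<Longrightarrow> tested S \<subseteq> {..<num_jobs I}"
  using test_job_less by (fastforce simp: tested_def)

lemma length_tests_eq_card_tested: "feasible m I S \<Longrightarrow> length (tests S) = card (tested S)"
  using distinct_card[OF distinct_tested_jobs] by (fastforce simp: tested_def)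

lemma makespan_geI:
  assumes "feasible m I S" "\<And>x. completed_by m I S x \<Longrightarrow> b \<le> x"
  shows "b \<le> makespan m I S"
  unfolding makespan_def using assms by (intro cInf_greatest) (auto simp: feasible_def)

lemma makespan_nonneg: "feasible m I S \<Longrightarrow> 0 \<le> makespan m I S"
  by (rule makespan_geI) (auto simp: completed_by_def)

lemma makespan_le: "completed_by m I S x \<Longrightarrow> makespan m I S \<le> x"
  unfolding makespan_def
  by (intro cInf_lower bdd_belowI[of _ 0]) (auto simp: completed_by_def)

lemma OPT_nonneg: "feasible m I S \<Longrightarrow> 0 \<le> OPT m I"
  unfolding OPT_def using makespan_nonneg by (intro cInf_greatest) auto

lemma OPT_le_makespan: "feasible m I S \<Longrightarrow> OPT m I \<le> makespan m I S"
  unfolding OPT_def using makespan_nonneg by (intro cInf_lower bdd_belowI[of _ 0]) auto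

lemma upper_bound_le_makespan:
  assumes "feasible m I S" "j < num_jobs I" "j \<notin> tested S"
  shows "upper_bound I ! j \<le> makespan m I S"
proof (rule makespan_geI[OF assms(1)])
  fix x assume "completed_by m I S x"
  then have "0 \<le> x" "work m S (Run j) x = upper_bound I ! j"
    using assms by (auto simp: completed_by_def)
  then show "upper_bound I ! j \<le> x"
    using work_le_elapsed_time[OF assms(1), of "Run j" 0 x] by auto
qed

lemma tested_eq_all_jobs:
  assumes "feasible m I S" "\<And>j. j < num_jobs I \<Longrightarrow> makespan m I S < upper_bound I ! j"
  shows "tested S = {..<num_jobs I}"
  using tested_subset[OF assms(1)] upper_bound_le_makespan[OF assms(1)] assms(2)
  by (fastforce simp: not_le[symmetric])

lemma test_completion_plus_proc_le_makespan:
  assumes "feasible m I S" "(j, \<tau>) \<in> set (tests S)"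
  shows "\<tau> + proc_time I ! j \<le> makespan m I S"
proof (rule makespan_geI[OF assms(1)])
  fix x assume completed: "completed_by m I S x"
  have "j \<in> tested S"
    using assms(2) by (force simp: tested_def)
  then have "work m S (Exec j) x = proc_time I ! j" "\<tau> \<le> x"
    using completed test_job_less[OF assms] assms(2) by (auto simp: completed_by_def)
  moreover have "work m S (Exec j) x \<le> max 0 (x - \<tau>)"
    using exec_after_test_completion[OF assms] by (intro work_le_elapsed_time[OF assms(1)])
  ultimately show "\<tau> + proc_time I ! j \<le> x"
    by auto
qed

lemma total_test_time_le_last_completion:
  assumes "feasible m I S" "0 \<le> \<tau>"
    and last: "\<And>j \<sigma>. (j, \<sigma>) \<in> set (tests S) \<Longrightarrow> \<sigma> \<le> \<tau>"
  shows "(\<Sum>j\<in>tested S. test_time I ! j) \<le> real m * \<tau>"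
proof -
  obtain x where completed: "completed_by m I S x"
    using assms(1) by (auto simp: feasible_def)
  have "(\<Sum>j\<in>tested S. test_time I ! j) = (\<Sum>j\<in>tested S. work m S (Test j) x)"
    using completed tested_subset[OF assms(1)]
    by (intro sum.cong) (auto simp: completed_by_def)
  also have "\<dots> = (\<Sum>a\<in>Test ` tested S. work m S a x)"
    by (simp add: sum.reindex inj_on_def)
  also have "\<dots> \<le> real m * \<tau>"
  proof (rule sum_work_le_machine_time[OF assms(1) _ assms(2)])
    fix a i y
    assume "a \<in> Test ` tested S" "i < m" "0 \<le> y" "activity S i y = Some a"
    then obtain j \<sigma> where "(j, \<sigma>) \<in> set (tests S)" "activity S i y = Some (Test j)"
      by (auto simp: tested_def)
    then show "y < \<tau>"
      using test_before_completion[OF assms(1)] last \<open>i < m\<close> \<open>0 \<le> y\<close> by (meson less_le_trans)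
  qed (simp add: finite_tested)
  finally show ?thesis .
qed

lemma average_test_time_plus_last_proc_le_makespan:
  assumes "feasible m I S" "tests S = ts @ [(j, \<tau>)]"
  shows "(\<Sum>k\<in>tested S. test_time I ! k) / real m + proc_time I ! j \<le> makespan m I S"
proof -
  have last_mem: "(j, \<tau>) \<in> set (tests S)"
    by (simp add: assms(2))
  then have "0 \<le> \<tau>"
    by (rule test_completion_nonneg[OF assms(1)])
  moreover have "\<sigma> \<le> \<tau>" if "(k, \<sigma>) \<in> set (tests S)" for k \<sigma>
    using that sorted_test_completions[OF assms(1)] by (auto simp: assms(2) sorted_append)
  ultimately have "(\<Sum>k\<in>tested S. test_time I ! k) \<le> real m * \<tau>"
    by (rule total_test_time_le_last_completion[OF assms(1)])
  then have "(\<Sum>k\<in>tested S. test_time I ! k) / real m \<le> \<tau>"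
    using \<open>0 \<le> \<tau>\<close> by (cases "m = 0") (auto simp: field_simps)
  then show ?thesis
    using test_completion_plus_proc_le_makespan[OF assms(1) last_mem] by linarith
qed

section \<open>Schedules that process each job without interruption\<close>

lemma find_eq_Some_iff_unique:
  assumes "\<And>x y. x \<in> set xs \<Longrightarrow> y \<in> set xs \<Longrightarrow> P x \<Longrightarrow> P y \<Longrightarrow> x = y"
  shows "find P xs = Some x \<longleftrightarrow> x \<in> set xs \<and> P x"
  using assms
  by (cases "find P xs") (auto simp: find_None_iff find_Some_iff in_set_conv_nth)

locale contiguous_placement =
  fixes m :: nat and I :: testing_instance and machine :: "nat \<Rightarrow> nat" and start :: "nat \<Rightarrow> real"
  assumes valid: "valid_instance I"
    and machine_less: "j < num_jobs I \<Longrightarrow> machine j < m"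
    and start_nonneg: "j < num_jobs I \<Longrightarrow> 0 \<le> start j"
    and disjoint: "\<lbrakk>j < num_jobs I; k < num_jobs I; j \<noteq> k; machine j = machine k\<rbrakk> \<Longrightarrow>
      {start j..<start j + test_time I ! j + proc_time I ! j} \<inter>
      {start k..<start k + test_time I ! k + proc_time I ! k} = {}"
begin

definition test_end :: "nat \<Rightarrow> real" where
  "test_end j = start j + test_time I ! j"

definition finish :: "nat \<Rightarrow> real" where
  "finish j = test_end j + proc_time I ! j"

definition contiguous_schedule :: schedule where
  "contiguous_schedule =
    \<lparr>activity = (\<lambda>i x. map_option (\<lambda>j. if x < test_end j then Test j else Exec j)
       (find (\<lambda>j. machine j = i \<and> start j \<le> x \<and> x < finish j) [0..<num_jobs I])),
     tests = sort_key snd (map (\<lambda>j. (j, test_end j)) [0..<num_jobs I])\<rparr>"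

lemma start_le_test_end: "j < num_jobs I \<Longrightarrow> start j \<le> test_end j"
  and test_end_le_finish: "j < num_jobs I \<Longrightarrow> test_end j \<le> finish j"
  using valid by (auto simp: test_end_def finish_def valid_instance_def)

lemma find_occupying_job:
  "find (\<lambda>j. machine j = i \<and> start j \<le> x \<and> x < finish j) [0..<num_jobs I] = Some j \<longleftrightarrow>
    j < num_jobs I \<and> machine j = i \<and> start j \<le> x \<and> x < finish j"
proof (subst find_eq_Some_iff_unique)
  fix k l
  assume "k \<in> set [0..<num_jobs I]" "l \<in> set [0..<num_jobs I]"
    "machine k = i \<and> start k \<le> x \<and> x < finish k" "machine l = i \<and> start l \<le> x \<and> x < finish l"
  then show "k = l"
    using disjoint[of k l] by (auto simp: finish_def test_end_def disjoint_iff)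
qed auto

lemma activity_Test_iff:
  "activity contiguous_schedule i x = Some (Test j) \<longleftrightarrow>
    j < num_jobs I \<and> i = machine j \<and> start j \<le> x \<and> x < test_end j"
  using test_end_le_finish[of j] by (auto simp: contiguous_schedule_def find_occupying_job)

lemma activity_Exec_iff:
  "activity contiguous_schedule i x = Some (Exec j) \<longleftrightarrow>
    j < num_jobs I \<and> i = machine j \<and> test_end j \<le> x \<and> x < finish j"
  using start_le_test_end[of j]
  by (auto simp: contiguous_schedule_def find_occupying_job intro!: exI[of _ j])

lemma activity_not_Run: "activity contiguous_schedule i x \<noteq> Some (Run j)"
  by (simp add: contiguous_schedule_def)

lemma activity_job:
  assumes "activity contiguous_schedule i x = Some a"
  shows "job_of a < num_jobs I" "machine (job_of a) = i" "a \<noteq> Run j"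
  using assms
  by (cases a; auto simp: activity_Test_iff activity_Exec_iff activity_not_Run)+

lemma activity_set_measurable:
  "{x. 0 \<le> x \<and> activity contiguous_schedule i x = Some a} \<in> sets lborel"
proof (cases a)
  case (Test j)
  then have "{x. 0 \<le> x \<and> activity contiguous_schedule i x = Some a} =
      (if j < num_jobs I \<and> i = machine j then {start j..<test_end j} else {})"
    using start_nonneg[of j] by (auto simp: activity_Test_iff)
  then show ?thesis by simp
next
  case (Exec j)
  then have "{x. 0 \<le> x \<and> activity contiguous_schedule i x = Some a} =
      (if j < num_jobs I \<and> i = machine j then {test_end j..<finish j} else {})"
    using start_nonneg[of j] start_le_test_end[of j] by (auto simp: activity_Exec_iff)
  then show ?thesis by simp
qed (simp add: activity_not_Run)

lemma set_tests_contiguous_schedule: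
  "set (tests contiguous_schedule) = (\<lambda>j. (j, test_end j)) ` {..<num_jobs I}"
  by (auto simp: contiguous_schedule_def)

lemma tested_contiguous_schedule: "tested contiguous_schedule = {..<num_jobs I}"
  unfolding tested_def set_tests_contiguous_schedule by (simp add: image_image)

lemma work_Test:
  assumes "j < num_jobs I"
  shows "work m contiguous_schedule (Test j) x = max 0 (min x (test_end j) - start j)"
  using assms
  by (intro work_single_interval[OF machine_less[OF assms]] start_nonneg)
    (auto simp: activity_Test_iff)

lemma work_Exec:
  assumes "j < num_jobs I"
  shows "work m contiguous_schedule (Exec j) x = max 0 (min x (finish j) - test_end j)"
  using assms start_nonneg[OF assms] start_le_test_end[OF assms]
  by (intro work_single_interval[OF machine_less[OF assms]]) (auto simp: activity_Exec_iff)

lemma contiguous_schedule_completed: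
  assumes "0 \<le> x" and finish_le: "\<And>j. j < num_jobs I \<Longrightarrow> finish j \<le> x"
  shows "completed_by m I contiguous_schedule x"
proof -
  have "work m contiguous_schedule a y = required_work I contiguous_schedule a"
    if "x \<le> y" for a y
  proof (cases "job_of a < num_jobs I \<and> a \<noteq> Run (job_of a)")
    case True
    then have "start (job_of a) \<le> test_end (job_of a)" "test_end (job_of a) \<le> finish (job_of a)"
      "finish (job_of a) \<le> y"
      using start_le_test_end test_end_le_finish finish_le \<open>x \<le> y\<close> by force+
    then show ?thesis
      using True
      by (cases a)
        (auto simp: work_Test work_Exec tested_contiguous_schedule test_end_def finish_def)
  next
    case False
    then have "work m contiguous_schedule a y = 0"
      using activity_job by (intro work_eq_0) metis
    then show ?thesis
      using False by (cases a) (auto simp: tested_contiguous_schedule)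
  qed
  moreover have "test_end j \<le> x" if "j < num_jobs I" for j
    using test_end_le_finish[OF that] finish_le[OF that] by linarith
  ultimately show ?thesis
    using assms(1) by (auto simp: completed_by_def set_tests_contiguous_schedule)
qed

lemma contiguous_schedule_well_timed: "well_timed_tests m I contiguous_schedule"
proof -
  have "distinct (map fst (tests contiguous_schedule))"
    by (auto simp: contiguous_schedule_def distinct_map inj_on_def)
  moreover have "sorted (map snd (tests contiguous_schedule))"
    by (simp add: contiguous_schedule_def)
  moreover have "0 \<le> test_end j" if "j < num_jobs I" for j
    using start_nonneg[OF that] start_le_test_end[OF that] by linarith
  moreover have "work m contiguous_schedule (Test j) x < test_time I ! j"
    if "j < num_jobs I" "0 < test_time I ! j" "x < test_end j" for j x
    using that by (simp add: work_Test test_end_def)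
  ultimately show ?thesis
    unfolding well_timed_tests_def set_tests_contiguous_schedule
    by (auto simp: activity_Test_iff activity_Exec_iff)
qed

lemma OPT_le_of_finish_le:
  assumes "0 \<le> x" "\<And>j. j < num_jobs I \<Longrightarrow> finish j \<le> x"
  shows "OPT m I \<le> x"
proof -
  have completed: "completed_by m I contiguous_schedule x"
    using assms by (rule contiguous_schedule_completed)
  have "job_of a \<noteq> job_of b"
    if "i \<noteq> i'" "activity contiguous_schedule i y = Some a"
      "activity contiguous_schedule i' y = Some b"
    for i i' y a b
    using that activity_job(2) by metis
  then have "feasible m I contiguous_schedule"
    unfolding feasible_def
    using activity_set_measurable activity_job(1,3) contiguous_schedule_well_timed completed
    by (auto simp: tested_contiguous_schedule)
  then show ?thesis
    using OPT_le_makespan makespan_le[OF completed] by (blast intro: order_trans)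
qed

end

section \<open>The adversary\<close>

definition with_proc_time :: "testing_instance \<Rightarrow> nat \<Rightarrow> real \<Rightarrow> testing_instance" where
  "with_proc_time I j p = I\<lparr>proc_time := (proc_time I)[j := p]\<rparr>"

lemma with_proc_time_simps [simp]:
  "test_time (with_proc_time I j p) = test_time I"
  "upper_bound (with_proc_time I j p) = upper_bound I"
  "proc_time (with_proc_time I j p) = (proc_time I)[j := p]"
  "num_jobs (with_proc_time I j p) = num_jobs I"
  by (simp_all add: with_proc_time_def num_jobs_def)

text \<open>Processing time \<open>p\<close> of the last job tested comes to light only when no test is left, so the
  whole testing phase is the same as for \<open>I\<close>.\<close>

lemma tests_with_proc_time_last:
  assumes online: "online_algorithm m K A"
    and I: "I \<in> K" and J: "with_proc_time I j p \<in> K"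
    and tests: "tests (A I) = ts @ [(j, \<tau>)]" and all: "tested (A I) = {..<num_jobs I}"
  shows "tests (A (with_proc_time I j p)) = tests (A I)"
proof -
  define J where "J = with_proc_time I j p"
  have feasible: "feasible m I (A I)" "feasible m J (A J)"
    using online I J by (auto simp: online_algorithm_def J_def)
  have "proc_time I ! k = proc_time J ! k" if "(k, \<sigma>) \<in> set ts" for k \<sigma>
  proof -
    have "k \<noteq> j"
      using distinct_tested_jobs[OF feasible(1)] that by (force simp: tests)
    then show ?thesis
      by (simp add: J_def)
  qed
  then have "take (Suc (length ts)) (tests (A I)) = take (Suc (length ts)) (tests (A J))"
    using online I J unfolding online_algorithm_def nonanticipating_def
    by (elim conjE ballE[of _ _ I] ballE[of _ _ J] allE[of _ "length ts"])
      (auto simp: tests J_def)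
  moreover have "length (tests (A I)) = num_jobs I"
    using length_tests_eq_card_tested[OF feasible(1)] by (simp add: all)
  moreover have "length (tests (A J)) \<le> num_jobs I"
    using length_tests_eq_card_tested[OF feasible(2)] tested_subset[OF feasible(2)]
      card_mono[of "{..<num_jobs I}"] by (simp add: J_def)
  ultimately show ?thesis
    by (simp add: tests J_def)
qed

lemma exists_job_forcing_makespan:
  assumes online: "online_algorithm m K A" and I: "I \<in> K"
    and valid: "valid_instance I" and nonempty: "0 < num_jobs I"
    and all: "tested (A I) = {..<num_jobs I}"
  obtains j where "j < num_jobs I"
    and "\<And>p. with_proc_time I j p \<in> K \<Longrightarrow>
      (\<Sum>k<num_jobs I. test_time I ! k) / real m + p
        \<le> makespan m (with_proc_time I j p) (A (with_proc_time I j p))"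
proof -
  obtain ts j \<tau> where tests: "tests (A I) = ts @ [(j, \<tau>)]"
    using all nonempty by (cases "tests (A I)" rule: rev_cases) (auto simp: tested_def)
  then have j: "j < num_jobs I"
    using all by (force simp: tested_def)
  show thesis
  proof (rule that[OF j])
    fix p assume J: "with_proc_time I j p \<in> K"
    note same_tests = tests_with_proc_time_last[OF online I J tests all]
    have "feasible m (with_proc_time I j p) (A (with_proc_time I j p))"
      using online J by (simp add: online_algorithm_def)
    from average_test_time_plus_last_proc_le_makespan[OF this same_tests[unfolded tests]]
    show "(\<Sum>k<num_jobs I. test_time I ! k) / real m + p
        \<le> makespan m (with_proc_time I j p) (A (with_proc_time I j p))"
      using all same_tests j valid by (simp add: tested_def valid_instance_def)
  qed
qed

definition unit_test_instance :: "nat \<Rightarrow> real \<Rightarrow> testing_instance" where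
  "unit_test_instance n u =
    \<lparr>test_time = replicate n 1, upper_bound = replicate n u, proc_time = replicate n 0\<rparr>"

lemma unit_test_instance_simps [simp]:
  "test_time (unit_test_instance n u) = replicate n 1"
  "upper_bound (unit_test_instance n u) = replicate n u"
  "proc_time (unit_test_instance n u) = replicate n 0"
  "num_jobs (unit_test_instance n u) = n"
  by (simp_all add: unit_test_instance_def num_jobs_def)

lemma with_proc_time_zero_unit_test_instance:
  "with_proc_time (unit_test_instance n u) j 0 = unit_test_instance n u"
  by (cases "j < n")
    (simp_all add: with_proc_time_def unit_test_instance_def
      list_update_same_conv list_update_beyond)

lemma with_proc_time_mem_unit_test_instances:
  assumes "0 \<le> p" "p \<le> u"
  shows "with_proc_time (unit_test_instance n u) j p \<in> unit_test_instances"
  using assms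
  by (cases "j < n") (auto simp: unit_test_instances_def valid_instance_def nth_list_update)

text \<open>Position \<open>k\<close> is slot \<open>k mod T\<close> of machine \<open>k div T\<close>. The last of \<open>(m - 1) * T + 1\<close> positions
  has the last machine to itself; the transposition gives it to the long job \<open>j\<close>.\<close>

definition slot_position :: "nat \<Rightarrow> nat \<Rightarrow> nat \<Rightarrow> nat \<Rightarrow> nat" where
  "slot_position m T j = Transposition.transpose j ((m - 1) * T)"

lemma slot_position_eq_iff: "slot_position m T j k = slot_position m T j l \<longleftrightarrow> k = l"
  unfolding slot_position_def by (blast dest: transpose_eq_imp_eq)

lemma slot_position_long_job:
  assumes "1 \<le> T"
  shows "slot_position m T j j div T = m - 1" "slot_position m T j j mod T = 0"
  using assms by (simp_all add: slot_position_def)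

lemma slot_position_div_less_other_job:
  assumes "j \<le> (m - 1) * T" "k \<le> (m - 1) * T" "k \<noteq> j"
  shows "slot_position m T j k div T < m - 1"
proof (rule less_mult_imp_div_less)
  show "slot_position m T j k < (m - 1) * T"
    using assms by (auto simp: slot_position_def Transposition.transpose_def)
qed

lemma contiguous_placement_slot_position:
  assumes "1 \<le> m" "1 \<le> T" and j: "j \<le> (m - 1) * T" and p: "0 \<le> p" "p \<le> u"
  shows "contiguous_placement m (with_proc_time (unit_test_instance (Suc ((m - 1) * T)) u) j p)
    (\<lambda>k. slot_position m T j k div T) (\<lambda>k. real (slot_position m T j k mod T))"
    (is "contiguous_placement m ?J ?machine ?start")
proof
  show "valid_instance ?J"
    using with_proc_time_mem_unit_test_instances p by (auto simp: unit_test_instances_def)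
  show "?machine k < m" if "k < num_jobs ?J" for k
    using that j assms(1) slot_position_long_job(1)[OF assms(2)]
      slot_position_div_less_other_job[of j m T k]
    by (cases "k = j") auto
next
  fix k l
  assume kl: "k < num_jobs ?J" "l < num_jobs ?J" "k \<noteq> l" "?machine k = ?machine l"
  have "?machine i < ?machine j" if "i < num_jobs ?J" "i \<noteq> j" for i
    using that slot_position_div_less_other_job[OF j, of i] slot_position_long_job(1)[OF assms(2)]
    by simp
  then have "k \<noteq> j" "l \<noteq> j"
    using kl by (metis less_irrefl)+
  moreover have "slot_position m T j k mod T \<noteq> slot_position m T j l mod T"
    using kl(3,4) by (metis slot_position_eq_iff div_mult_mod_eq)
  ultimately show "{?start k..<?start k + test_time ?J ! k + proc_time ?J ! k} \<inter>
      {?start l..<?start l + test_time ?J ! l + proc_time ?J ! l} = {}"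
    using kl(1,2) by (auto simp: disjoint_iff simp del: replicate_Suc)
qed simp

lemma OPT_one_long_job_le:
  assumes "1 \<le> m" "1 \<le> T" "j \<le> (m - 1) * T" and p: "0 \<le> p" "p \<le> real T - 1" "p \<le> u"
  shows "OPT m (with_proc_time (unit_test_instance (Suc ((m - 1) * T)) u) j p) \<le> real T"
    (is "OPT m ?J \<le> _")
proof -
  interpret contiguous_placement m ?J "\<lambda>k. slot_position m T j k div T"
    "\<lambda>k. real (slot_position m T j k mod T)"
    using assms by (intro contiguous_placement_slot_position)
  show ?thesis
  proof (rule OPT_le_of_finish_le)
    fix k assume "k < num_jobs ?J"
    moreover have "slot_position m T j k mod T < T"
      using assms(2) by simp
    then have "real (slot_position m T j k mod T) + 1 \<le> real T"
      by linarith
    ultimately show "finish k \<le> real T"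
      unfolding finish_def test_end_def using p slot_position_long_job(2)[OF assms(2)]
      by (cases "k = j") (auto simp del: replicate_Suc)
  qed simp
qed

lemma competitive_makespan_le:
  assumes "online_algorithm m K A" "competitive m K c A" "I \<in> K" "OPT m I \<le> x"
  shows "makespan m I (A I) \<le> max 0 c * x"
proof -
  have "0 \<le> OPT m I"
    using assms OPT_nonneg by (auto simp: online_algorithm_def)
  have "makespan m I (A I) \<le> c * OPT m I"
    using assms by (simp add: competitive_def)
  also have "\<dots> \<le> max 0 c * x"
    using \<open>0 \<le> OPT m I\<close> assms(4) by (intro mult_mono) auto
  finally show ?thesis .
qed

lemma test_plus_long_job_le_competitive_bound:
  fixes c p x :: real
  assumes K: "unit_test_instances \<subseteq> K"
    and online: "online_algorithm m K A" and competitive: "competitive m K c A"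
    and n: "0 < n" and p: "0 \<le> p"
    and OPT_le: "\<And>j q u. \<lbrakk>j < n; 0 \<le> q; q \<le> p; p \<le> u\<rbrakk> \<Longrightarrow>
      OPT m (with_proc_time (unit_test_instance n u) j q) \<le> x"
  shows "real n / real m + p \<le> max 0 c * x"
proof -
  define u where "u = \<bar>max 0 c * x\<bar> + p + 1"
  define I where "I = unit_test_instance n u"
  have p_le_u: "p \<le> u"
    by (simp add: u_def)
  then have unit_test: "with_proc_time I j q \<in> unit_test_instances" if "0 \<le> q" "q \<le> p" for j q
    unfolding I_def using that by (intro with_proc_time_mem_unit_test_instances) auto
  have ALG_le: "makespan m (with_proc_time I j q) (A (with_proc_time I j q)) \<le> max 0 c * x"
    if "j < n" "0 \<le> q" "q \<le> p" for j q
    using unit_test K OPT_le p_le_u that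
    by (intro competitive_makespan_le[OF online competitive]) (auto simp: I_def)
  have I: "I \<in> unit_test_instances" "makespan m I (A I) \<le> max 0 c * x"
    using unit_test[of 0] ALG_le[of 0 0] n p
    by (simp_all add: I_def with_proc_time_zero_unit_test_instance)
  have "makespan m I (A I) < u"
    using I(2) p unfolding u_def by linarith
  then have "tested (A I) = {..<num_jobs I}"
    using online I(1) K by (intro tested_eq_all_jobs) (auto simp: online_algorithm_def I_def)
  moreover have "I \<in> K" "valid_instance I" "0 < num_jobs I"
    using I(1) K n by (auto simp: unit_test_instances_def I_def)
  ultimately obtain j where j: "j < num_jobs I"
    and forced: "\<And>q. with_proc_time I j q \<in> K \<Longrightarrow>
      (\<Sum>k<num_jobs I. test_time I ! k) / real m + q
        \<le> makespan m (with_proc_time I j q) (A (with_proc_time I j q))"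
    using exists_job_forcing_makespan[OF online] by metis
  have "real n / real m + p \<le> makespan m (with_proc_time I j p) (A (with_proc_time I j p))"
    using forced[of p] unit_test K p by (auto simp: I_def)
  also have "\<dots> \<le> max 0 c * x"
    using j p by (intro ALG_le) (simp_all add: I_def)
  finally show ?thesis .
qed

lemma competitive_ratio_ge:
  fixes c :: real and m T :: nat
  assumes m: "1 \<le> m" and T: "1 \<le> T" and "unit_test_instances \<subseteq> K"
    and "online_algorithm m K A" "competitive m K c A"
  shows "2 - 1 / real m - (1 - 1 / real m) / real T \<le> c"
proof -
  define n where "n = Suc ((m - 1) * T)"
  have "(2 - 1 / real m - (1 - 1 / real m) / real T) * real T = real n / real m + (real T - 1)"
    using m T by (simp add: n_def of_nat_diff field_simps)
  also have "\<dots> \<le> max 0 c * real T"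
    using assms OPT_one_long_job_le[OF m T]
    by (intro test_plus_long_job_le_competitive_bound[where n = n]) (auto simp: n_def)
  finally have "2 - 1 / real m - (1 - 1 / real m) / real T \<le> max 0 c"
    using T by simp
  moreover have "(1 - 1 / real m) / real T \<le> (1 - 1 / real m) / 1"
    using m T by (intro divide_left_mono) auto
  ultimately show ?thesis
    by (auto simp: le_max_iff_disj)
qed

theorem theorem6:
  fixes m :: nat and c :: real
  assumes "m \<ge> 1" and "c < 2 - 2 / real m + 1 / (real m)\<^sup>2"
  shows "\<not> (\<exists>A. online_algorithm m all_instances A \<and> competitive m all_instances c A) \<and>
    \<not> (\<exists>A. online_algorithm m unit_test_instances A \<and> competitive m unit_test_instances c A)"
proof -
  have "2 - 1 / real m - (1 - 1 / real m) / real m = 2 - 2 / real m + 1 / (real m)\<^sup>2"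
    using assms(1) by (simp add: field_simps power2_eq_square)
  then have "\<not> competitive m K c A"
    if "unit_test_instances \<subseteq> K" "online_algorithm m K A" for K A
    using competitive_ratio_ge[OF assms(1) assms(1) that] assms(2) by fastforce
  moreover have "unit_test_instances \<subseteq> all_instances"
    by (auto simp: unit_test_instances_def all_instances_def)
  ultimately show ?thesis
    by blast
qed

end
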